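(* Let $K$ be an algebraically closed field of characteristic $\neq 2$, let $R=K[x_1,\ldots,x_N]$ be a polynomial ring, let $k$ be a positive integer, and let $V\subseteq R$ be a $K$-vector space of quadratic forms that is not contained in any ideal of $R$ generated by $2k$ or fewer linear forms. Then there exists a Zariski dense open subset of $V$ consisting of quadratic forms with no $k$-collapse.
   Context: A form (homogeneous polynomial) $F$ has a $k$-collapse if $F=\sum_{i=1}^{k}G_iH_i$, where each $G_i$ is a form of positive degree strictly less than $\deg F$ (or is $0$) and each $H_i$ is a form of degree $\deg F-\deg G_i$ (or is $0$). For a quadratic form this means that $F$ is in an ideal generated by at most $k$ linear forms. In particular $0$ has a $k$-collapse for every $k$. $V$ is finite-dimensional and carries the Zariski topology of affine space. *)

theory Defs
  imports
    "HOL-Computational_Algebra.Polynomial"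
    "HOL-Library.Poly_Mapping"
    "HOL-Analysis.Abstract_Topology"
begin

text \<open>
  The polynomial ring over \<^typ>\<open>'a\<close> in finitely many variables: the variables are the elements
  of the finite type \<^typ>\<open>'n\<close>, so that their number is \<open>CARD('n)\<close>. A polynomial is a finitely
  supported map from exponent vectors to coefficients; its product is the convolution product.
\<close>

type_synonym ('n, 'a) mpoly = "('n \<Rightarrow>\<^sub>0 nat) \<Rightarrow>\<^sub>0 'a"

definition mscale :: "'a::comm_ring_1 \<Rightarrow> ('n, 'a) mpoly \<Rightarrow> ('n, 'a) mpoly"
  where "mscale c F = Poly_Mapping.single 0 c * F"

global_interpretation mpoly: vector_space
  "mscale :: 'a::field \<Rightarrow> ('n, 'a) mpoly \<Rightarrow> ('n, 'a) mpoly"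
  by unfold_locales
    (simp_all only: mscale_def distrib_left distrib_right single_add mult_single mult_1_left
      single_one add_0_left flip: mult.assoc)

text \<open>
  A ring viewed as a module over itself: \<open>ideal.span L\<close> is the ideal generated by \<open>L\<close>.
\<close>

global_interpretation ideal: module "(*) :: 'r::comm_ring_1 \<Rightarrow> 'r \<Rightarrow> 'r"
  by unfold_locales (simp_all only: distrib_left distrib_right mult.assoc mult_1_left)


section \<open>Forms and collapses\<close>

definition monom_degree :: "('n::finite \<Rightarrow>\<^sub>0 nat) \<Rightarrow> nat"
  where "monom_degree m = (\<Sum>i\<in>UNIV. Poly_Mapping.lookup m i)"

text \<open>Total degree; the zero polynomial gets degree 0.\<close>

definition total_degree :: "('n::finite, 'a::zero) mpoly \<Rightarrow> nat"
  where "total_degree F = Max (insert 0 (monom_degree ` Poly_Mapping.keys F))"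

text \<open>The zero polynomial is homogeneous of every degree.\<close>

definition homogeneous :: "nat \<Rightarrow> ('n::finite, 'a::zero) mpoly \<Rightarrow> bool"
  where "homogeneous d F \<longleftrightarrow> (\<forall>m\<in>Poly_Mapping.keys F. monom_degree m = d)"

definition is_form :: "('n::finite, 'a::zero) mpoly \<Rightarrow> bool"
  where "is_form F \<longleftrightarrow> (\<exists>d. homogeneous d F)"

text \<open>
  The natural-number subtraction below never truncates, since
  \<open>total_degree (G i) \<le> total_degree F\<close> in both cases. For \<open>F = 0\<close> the condition on \<open>G i\<close> forces
  \<open>G i = 0\<close>, and \<open>0\<close> has a \<open>k\<close>-collapse for every \<open>k\<close>.
\<close>

definition has_collapse :: "nat \<Rightarrow> ('n::finite, 'a::comm_ring_1) mpoly \<Rightarrow> bool"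
  where "has_collapse k F \<longleftrightarrow> (\<exists>G H. F = (\<Sum>i=1..k. G i * H i) \<and>
    (\<forall>i\<in>{1..k}.
      (G i = 0 \<or>
        is_form (G i) \<and> 0 < total_degree (G i) \<and> total_degree (G i) < total_degree F) \<and>
      (H i = 0 \<or>
        is_form (H i) \<and> total_degree (H i) = total_degree F - total_degree (G i))))"

lemma has_collapse_0: "has_collapse k 0"
  unfolding has_collapse_def by (intro exI[of _ "\<lambda>_. 0"]) simp


section \<open>The Zariski topology of a vector space of polynomials\<close>

text \<open>
  On a finite-dimensional space \<open>V\<close>, the linear functionals are the homogeneous linear polynomials
  in the coordinates with respect to any basis, so the functions on \<open>V\<close> that are polynomial in the
  coordinates form the algebra generated by the linear functionals. Functions are total on the
  ambient ring, but only their values on \<open>V\<close> matter.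
\<close>

definition linear_functional_on ::
    "('n, 'a::field) mpoly set \<Rightarrow> (('n, 'a) mpoly \<Rightarrow> 'a) \<Rightarrow> bool"
  where "linear_functional_on V l \<longleftrightarrow>
    (\<forall>F\<in>V. \<forall>G\<in>V. l (F + G) = l F + l G) \<and> (\<forall>c. \<forall>F\<in>V. l (mscale c F) = c * l F)"

inductive_set polynomial_functions ::
    "('n, 'a::field) mpoly set \<Rightarrow> (('n, 'a) mpoly \<Rightarrow> 'a) set"
  for V :: "('n, 'a) mpoly set"
  where
    const: "(\<lambda>_. c) \<in> polynomial_functions V"
  | linear: "linear_functional_on V l \<Longrightarrow> l \<in> polynomial_functions V"
  | add: "p \<in> polynomial_functions V \<Longrightarrow> q \<in> polynomial_functions V \<Longrightarrow>
      (\<lambda>F. p F + q F) \<in> polynomial_functions V"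
  | mult: "p \<in> polynomial_functions V \<Longrightarrow> q \<in> polynomial_functions V \<Longrightarrow>
      (\<lambda>F. p F * q F) \<in> polynomial_functions V"

definition zero_locus ::
    "('n, 'a::field) mpoly set \<Rightarrow> (('n, 'a) mpoly \<Rightarrow> 'a) set \<Rightarrow> ('n, 'a) mpoly set"
  where "zero_locus V P = {F \<in> V. \<forall>p\<in>P. p F = 0}"

definition zariski_closed :: "('n, 'a::field) mpoly set \<Rightarrow> ('n, 'a) mpoly set \<Rightarrow> bool"
  where "zariski_closed V Z \<longleftrightarrow> (\<exists>P \<subseteq> polynomial_functions V. Z = zero_locus V P)"

definition zariski_topology :: "('n, 'a::field) mpoly set \<Rightarrow> ('n, 'a) mpoly topology"
  where "zariski_topology V = topology (\<lambda>U. U \<subseteq> V \<and> zariski_closed V (V - U))"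

lemma zariski_closed_Un:
  assumes "zariski_closed V Y" "zariski_closed V Z"
  shows "zariski_closed V (Y \<union> Z)"
proof -
  obtain P Q where P: "P \<subseteq> polynomial_functions V" "Y = zero_locus V P"
    and Q: "Q \<subseteq> polynomial_functions V" "Z = zero_locus V Q"
    using assms unfolding zariski_closed_def by blast
  let ?R = "{(\<lambda>F. p F * q F) | p q. p \<in> P \<and> q \<in> Q}"
  have "?R \<subseteq> polynomial_functions V"
    using P(1) Q(1) by (auto intro: polynomial_functions.mult)
  moreover have "Y \<union> Z = zero_locus V ?R"
  proof (intro set_eqI iffI)
    fix F assume F: "F \<in> zero_locus V ?R"
    hence V: "F \<in> V"
      by (simp add: zero_locus_def)
    have *: "p F * q F = 0" if "p \<in> P" "q \<in> Q" for p q
    proof -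
      have R: "(\<lambda>F. p F * q F) \<in> ?R"
        using that by (intro CollectI exI conjI) (rule refl)
      have "\<forall>r\<in>?R. r F = 0"
        using F unfolding zero_locus_def by (elim CollectE conjE)
      from bspec[OF this R] show ?thesis .
    qed
    show "F \<in> Y \<union> Z"
    proof (cases "\<forall>p\<in>P. p F = 0")
      case True
      thus ?thesis
        using V by (simp add: P(2) zero_locus_def)
    next
      case False
      then obtain p where "p \<in> P" "p F \<noteq> 0"
        by blast
      hence "\<forall>q\<in>Q. q F = 0"
        using * by (metis mult_eq_0_iff)
      thus ?thesis
        using V by (simp add: Q(2) zero_locus_def)
    qed
  next
    fix F assume "F \<in> Y \<union> Z"
    thus "F \<in> zero_locus V ?R"
      unfolding P(2) Q(2) zero_locus_def by auto
  qed
  ultimately show ?thesis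
    unfolding zariski_closed_def by blast
qed

lemma zariski_closed_Inter:
  assumes "\<And>Z. Z \<in> \<Z> \<Longrightarrow> zariski_closed V Z"
  shows "zariski_closed V (V \<inter> \<Inter>\<Z>)"
proof -
  obtain P where P: "\<And>Z. Z \<in> \<Z> \<Longrightarrow> P Z \<subseteq> polynomial_functions V"
    "\<And>Z. Z \<in> \<Z> \<Longrightarrow> Z = zero_locus V (P Z)"
    using assms unfolding zariski_closed_def by metis
  have "F \<in> V \<inter> \<Inter>\<Z> \<longleftrightarrow> F \<in> zero_locus V (\<Union>Z\<in>\<Z>. P Z)" for F
    using P(2) unfolding zero_locus_def by blast
  hence "V \<inter> \<Inter>\<Z> = zero_locus V (\<Union>Z\<in>\<Z>. P Z)"
    by blast
  moreover have "(\<Union>Z\<in>\<Z>. P Z) \<subseteq> polynomial_functions V"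
    using P(1) by blast
  ultimately show ?thesis
    unfolding zariski_closed_def by blast
qed

lemma istopology_zariski: "istopology (\<lambda>U. U \<subseteq> V \<and> zariski_closed V (V - U))"
  unfolding istopology_def
proof (intro conjI allI impI)
  fix S T assume "S \<subseteq> V \<and> zariski_closed V (V - S)" "T \<subseteq> V \<and> zariski_closed V (V - T)"
  thus "zariski_closed V (V - S \<inter> T)"
    using zariski_closed_Un[of V "V - S" "V - T"] by (simp add: Diff_Int)
next
  fix \<K> assume *: "\<forall>K\<in>\<K>. K \<subseteq> V \<and> zariski_closed V (V - K)"
  have "V - \<Union>\<K> = V \<inter> \<Inter>((\<lambda>K. V - K) ` \<K>)"
    by blast
  thus "zariski_closed V (V - \<Union>\<K>)"
    using * zariski_closed_Inter[of "(\<lambda>K. V - K) ` \<K>" V] by (metis (no_types, lifting) imageE)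
qed blast+

lemma openin_zariski: "openin (zariski_topology V) U \<longleftrightarrow> U \<subseteq> V \<and> zariski_closed V (V - U)"
  unfolding zariski_topology_def by (simp add: istopology_zariski)

lemma zariski_closed_self: "zariski_closed V V"
  unfolding zariski_closed_def by (intro exI[of _ "{}"]) (auto simp: zero_locus_def)

lemma zariski_closed_empty: "zariski_closed V {}"
  unfolding zariski_closed_def
  by (intro exI[of _ "{\<lambda>_. 1}"]) (auto simp: zero_locus_def intro: polynomial_functions.const)

lemma topspace_zariski: "topspace (zariski_topology V) = V"
proof
  show "topspace (zariski_topology V) \<subseteq> V"
    using openin_topspace[of "zariski_topology V"] unfolding openin_zariski by blast
  have "openin (zariski_topology V) V"
    unfolding openin_zariski by (simp add: zariski_closed_empty)
  thus "V \<subseteq> topspace (zariski_topology V)"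
    by (rule openin_subset)
qed

lemma closedin_zariski: "closedin (zariski_topology V) Z \<longleftrightarrow> zariski_closed V Z"
proof -
  have "zariski_closed V Z \<Longrightarrow> Z \<subseteq> V"
    unfolding zariski_closed_def zero_locus_def by blast
  thus ?thesis
    unfolding closedin_def topspace_zariski openin_zariski
    by (auto simp: double_diff)
qed

end

theory Submission
  imports Defs "Jordan_Normal_Form.Determinant"
begin

text \<open>
  In characteristic different from 2 a quadratic form \<open>F\<close> is the same thing as its polar form,
  the symmetric bilinear form \<open>B\<^sub>F(u, v) = F(u + v) - F(u) - F(v)\<close>. A product of two linear forms
  \<open>g h\<close> has polar form \<open>g(u) h(v) + h(u) g(v)\<close>, of rank at most 2, so a form with a \<open>k\<close>-collapse
  has a polar form of rank at most \<open>2k\<close>: every determinant of size \<open>2k + 1\<close> with entries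
  \<open>B\<^sub>F(u\<^sub>i, v\<^sub>j)\<close> vanishes (\<open>collapse_polar_minor\<close>). For fixed vectors such a determinant is a polynomial
  function of \<open>F\<close>. So if some determinant of this size is nonzero at some point of \<open>V\<close>, the set
  where it does not vanish is open and consists of forms without a \<open>k\<close>-collapse; it is dense
  because two nonempty open sets meet on the line through a point of each, a nonzero polynomial in
  one variable having only finitely many roots in the infinite field.

  It remains to exclude that all these determinants vanish on \<open>V\<close>
  (\<open>bounded_rank_imp_in_linear_ideal\<close>). Let \<open>r \<le> 2k\<close> be the largest rank on \<open>V\<close>, attained at \<open>F\<close>,
  and let \<open>W\<close> be the kernel of \<open>B\<^sub>F\<close>, which is cut out by \<open>r\<close> linear forms. Every \<open>G \<in> V\<close> vanishes
  on \<open>W\<close>: border an invertible \<open>r \<times> r\<close> block of \<open>B\<^sub>F\<close> with \<open>w \<in> W\<close> on both sides; the bordered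
  determinant of \<open>F + t G\<close> is zero for all \<open>t\<close>, and its coefficient at \<open>t\<close> is \<open>B\<^sub>G(w, w)\<close> times the
  determinant of the block. A quadratic form that vanishes on \<open>W\<close> lies in the ideal generated by
  the \<open>r\<close> linear forms that define \<open>W\<close>. So \<open>V\<close> would lie in an ideal generated by at most
  \<open>2k\<close> linear forms, against the hypothesis.
\<close>

(* As a rewrite rule, this instance of scalar associativity is the reverse of mult.assoc, and the
   two together send the simplifier into a loop. *)
declare ideal.scale_scale [simp del]

section \<open>Functions that restrict to polynomials on lines\<close>

text \<open>
  Over a finite field, \<open>1 + \<Prod>\<^sub>a (x - a)\<close> has no root.
\<close>

lemma infinite_alg_closed: "infinite (UNIV :: 'a::alg_closed_field set)"
proof
  assume fin: "finite (UNIV :: 'a set)"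
  define q :: "'a poly" where "q = (\<Prod>a\<in>UNIV. [:- a, 1:])"
  have "degree q = card (UNIV :: 'a set)"
    unfolding q_def by (subst degree_prod_eq_sum_degree) auto
  hence "degree (q + 1) > 0"
    using fin by (subst degree_add_eq_left) (auto simp: card_gt_0_iff)
  then obtain x where "poly (q + 1) x = 0"
    using alg_closed_imp_poly_has_root by blast
  moreover have "poly q x = 0"
    unfolding q_def poly_prod using fin by (intro prod_zero) auto
  ultimately show False
    by simp
qed

lemma permutes_less: "p permutes {0..<n} \<Longrightarrow> i < n \<Longrightarrow> p i < (n :: nat)"
  using permutes_in_image[of p "{0..<n}" i] by simp

text \<open>
  The Leibniz formula uses only constants, sums and products. The lemma serves both for
  polynomial functions of a form and for polynomials in the parameter of a line, hence the
  abstract function algebra \<open>S\<close>.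
\<close>

lemma det_in_function_algebra:
  fixes S :: "('x \<Rightarrow> 'a::comm_ring_1) set"
  assumes const: "\<And>c. (\<lambda>_. c) \<in> S"
    and add: "\<And>p q. p \<in> S \<Longrightarrow> q \<in> S \<Longrightarrow> (\<lambda>x. p x + q x) \<in> S"
    and mult: "\<And>p q. p \<in> S \<Longrightarrow> q \<in> S \<Longrightarrow> (\<lambda>x. p x * q x) \<in> S"
    and entries: "\<And>i j. i < n \<Longrightarrow> j < n \<Longrightarrow> e i j \<in> S"
  shows "(\<lambda>x. det (mat n n (\<lambda>(i, j). e i j x))) \<in> S"
proof -
  have sum: "(\<lambda>x. \<Sum>i\<in>I. p i x) \<in> S" if "finite I" "\<And>i. i \<in> I \<Longrightarrow> p i \<in> S"
    for I :: "(nat \<Rightarrow> nat) set" and p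
    using that by (induction I rule: finite_induct) (simp_all add: const add)
  have prod: "(\<lambda>x. \<Prod>i\<in>I. p i x) \<in> S" if "finite I" "\<And>i. i \<in> I \<Longrightarrow> p i \<in> S"
    for I :: "nat set" and p
    using that by (induction I rule: finite_induct) (simp_all add: const mult)
  have "(\<lambda>x. \<Sum>\<pi> | \<pi> permutes {0..<n}. signof \<pi> * (\<Prod>i = 0..<n. e i (\<pi> i) x)) \<in> S"
    by (intro sum mult const prod) (auto intro!: entries simp: finite_permutations permutes_less)
  also have "(\<lambda>x. \<Sum>\<pi> | \<pi> permutes {0..<n}. signof \<pi> * (\<Prod>i = 0..<n. e i (\<pi> i) x)) =
      (\<lambda>x. det (mat n n (\<lambda>(i, j). e i j x)))"
    unfolding det_def by (intro ext) (auto intro!: sum.cong prod.cong simp: permutes_less)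
  finally show ?thesis .
qed

text \<open>
  Polynomials as functions: the entries and determinants below depend on a parameter \<open>t\<close>, and a
  set of functions is what \<open>det_in_function_algebra\<close> applies to.
\<close>

definition polynomial_in_one_var :: "('a::comm_ring_1 \<Rightarrow> 'a) set"
  where "polynomial_in_one_var = range poly"

lemma polynomial_in_one_var_intros:
  shows "(\<lambda>_. c) \<in> polynomial_in_one_var"
    and "(\<lambda>t. t) \<in> polynomial_in_one_var"
    and "p \<in> polynomial_in_one_var \<Longrightarrow> q \<in> polynomial_in_one_var \<Longrightarrow>
      (\<lambda>t. p t + q t) \<in> polynomial_in_one_var"
    and "p \<in> polynomial_in_one_var \<Longrightarrow> q \<in> polynomial_in_one_var \<Longrightarrow>
      (\<lambda>t. p t * q t) \<in> polynomial_in_one_var"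
proof -
  show "(\<lambda>_. c) \<in> polynomial_in_one_var"
    unfolding polynomial_in_one_var_def by (intro range_eqI[of _ _ "[:c:]"]) auto
  show "(\<lambda>t. t) \<in> polynomial_in_one_var"
    unfolding polynomial_in_one_var_def by (intro range_eqI[of _ _ "[:0, 1:]"]) auto
  assume "p \<in> polynomial_in_one_var" "q \<in> polynomial_in_one_var"
  then obtain P Q where "p = poly P" "q = poly Q"
    unfolding polynomial_in_one_var_def by blast
  thus "(\<lambda>t. p t + q t) \<in> polynomial_in_one_var" "(\<lambda>t. p t * q t) \<in> polynomial_in_one_var"
    unfolding polynomial_in_one_var_def
    by (intro range_eqI[of _ _ "P + Q"], auto) (intro range_eqI[of _ _ "P * Q"], auto)
qed

lemma polynomial_in_one_var_eq_0:
  fixes p :: "'a::idom \<Rightarrow> 'a"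
  assumes "infinite (UNIV :: 'a set)" "p \<in> polynomial_in_one_var"
    and "finite T" "\<And>t. t \<notin> T \<Longrightarrow> p t = 0"
  shows "p t = 0"
proof -
  obtain P where P: "p = poly P"
    using assms(2) unfolding polynomial_in_one_var_def by blast
  have "infinite (- T)"
    using assms(1,3) by (metis Compl_partition finite_UnI)
  moreover have "- T \<subseteq> {t. poly P t = 0}"
    using assms(4) P by auto
  ultimately have "P = 0"
    using poly_roots_finite finite_subset by blast
  thus ?thesis
    using P by simp
qed

lemma nonzero_polynomials_common_nonzero:
  fixes p q :: "'a::idom \<Rightarrow> 'a"
  assumes "infinite (UNIV :: 'a set)" "p \<in> polynomial_in_one_var" "q \<in> polynomial_in_one_var"
    and "p s \<noteq> 0" "q t \<noteq> 0"
  shows "\<exists>x. p x \<noteq> 0 \<and> q x \<noteq> 0"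
proof -
  obtain P Q where PQ: "p = poly P" "q = poly Q"
    using assms(2,3) unfolding polynomial_in_one_var_def by blast
  hence "P * Q \<noteq> 0"
    using assms(4,5) by auto
  then obtain x where "poly (P * Q) x \<noteq> 0"
    using poly_roots_finite[of "P * Q"] assms(1) by (metis (mono_tags, lifting) UNIV_eq_I mem_Collect_eq)
  thus ?thesis
    using PQ by auto
qed

lemma polynomial_function_on_line:
  assumes "p \<in> polynomial_functions V" "mpoly.subspace V" "F \<in> V" "G \<in> V"
  shows "(\<lambda>t. p (F + mscale t G)) \<in> polynomial_in_one_var"
  using assms(1)
proof induction
  case (linear l)
  have "l (F + mscale t G) = l F + t * l G" for t
    using linear assms(2-4) mpoly.subspace_scale unfolding linear_functional_on_def by metis
  thus ?case
    by (simp add: polynomial_in_one_var_intros)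
qed (simp_all add: polynomial_in_one_var_intros)

lemma nonvanishing_set_open:
  assumes "p \<in> polynomial_functions V"
  shows "openin (zariski_topology V) {F \<in> V. p F \<noteq> 0}"
proof -
  have "V - {F \<in> V. p F \<noteq> 0} = zero_locus V {p}"
    unfolding zero_locus_def by auto
  thus ?thesis
    using assms unfolding openin_zariski zariski_closed_def by blast
qed

text \<open>
  Density is checked on lines: a point of another nonempty open set is a point \<open>G\<close> where some
  polynomial function \<open>q\<close> does not vanish, and on the line from \<open>F\<close> to \<open>G\<close> both \<open>p\<close> and \<open>q\<close> are
  nonzero polynomials in the parameter, so some point of the line lies in both sets.
\<close>

lemma nonvanishing_set_dense:
  fixes V :: "('n, 'a::field) mpoly set"
  assumes inf: "infinite (UNIV :: 'a set)" and V: "mpoly.subspace V"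
    and p: "p \<in> polynomial_functions V" and F: "F \<in> V" "p F \<noteq> 0"
  shows "zariski_topology V closure_of {F \<in> V. p F \<noteq> 0} = V"
proof (intro equalityI subsetI)
  fix G assume "G \<in> zariski_topology V closure_of {F \<in> V. p F \<noteq> 0}"
  thus "G \<in> V"
    by (simp add: in_closure_of topspace_zariski)
next
  fix G assume G: "G \<in> V"
  show "G \<in> zariski_topology V closure_of {F \<in> V. p F \<noteq> 0}"
    unfolding in_closure_of topspace_zariski
  proof (intro conjI allI impI)
    fix T assume T: "G \<in> T \<and> openin (zariski_topology V) T"
    then obtain P where P: "P \<subseteq> polynomial_functions V" "V - T = zero_locus V P" and "T \<subseteq> V"
      unfolding openin_zariski zariski_closed_def by blast
    then obtain q where q: "q \<in> P" "q G \<noteq> 0"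
      using T G unfolding zero_locus_def by blast
    define H where "H t = F + mscale t (G - F)" for t
    have H: "H t \<in> V" for t
      unfolding H_def using V F G mpoly.subspace_add mpoly.subspace_scale mpoly.subspace_diff by metis
    have "H 0 = F" "H 1 = G"
      unfolding H_def by simp_all
    hence "\<exists>t. p (H t) \<noteq> 0 \<and> q (H t) \<noteq> 0"
      using q P(1) p F G V mpoly.subspace_diff[OF V G F(1)]
      by (intro nonzero_polynomials_common_nonzero[OF inf, of _ _ 0 1])
        (auto simp: H_def intro!: polynomial_function_on_line)
    then obtain t where t: "p (H t) \<noteq> 0" "q (H t) \<noteq> 0"
      by blast
    hence "H t \<in> T"
      using H q(1) P(2) unfolding zero_locus_def by blast
    thus "\<exists>F. F \<in> {F \<in> V. p F \<noteq> 0} \<and> F \<in> T"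
      using H t by blast
  qed (use G in auto)
qed

section \<open>The polar form of a quadratic form\<close>

abbreviation var :: "'n \<Rightarrow> 'n \<Rightarrow>\<^sub>0 nat"
  where "var i \<equiv> Poly_Mapping.single i 1"

text \<open>
  The entries of the Hessian matrix: twice the coefficient of a square, and once the coefficient
  of a mixed monomial. With this normalisation \<open>polar F u v\<close> is \<open>F(u + v) - F(u) - F(v)\<close> for a
  quadratic form \<open>F\<close>, without any division by 2.
\<close>

definition polar_coeff :: "('n, 'a::comm_ring_1) mpoly \<Rightarrow> 'n \<Rightarrow> 'n \<Rightarrow> 'a"
  where "polar_coeff F i j = (if i = j then 2 else 1) * Poly_Mapping.lookup F (var i + var j)"

definition polar :: "('n::finite, 'a::comm_ring_1) mpoly \<Rightarrow> ('n \<Rightarrow> 'a) \<Rightarrow> ('n \<Rightarrow> 'a) \<Rightarrow> 'a"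
  where "polar F u v = (\<Sum>i\<in>UNIV. \<Sum>j\<in>UNIV. polar_coeff F i j * u i * v j)"

definition linear_form :: "('n::finite \<Rightarrow> 'a::comm_ring_1) \<Rightarrow> ('n, 'a) mpoly"
  where "linear_form c = (\<Sum>i\<in>UNIV. Poly_Mapping.single (var i) (c i))"

definition dual_pairing :: "('n::finite \<Rightarrow> 'a::comm_ring_1) \<Rightarrow> ('n \<Rightarrow> 'a) \<Rightarrow> 'a"
  where "dual_pairing c u = (\<Sum>i\<in>UNIV. c i * u i)"

definition basis_vec :: "'n \<Rightarrow> 'n \<Rightarrow> 'a::comm_ring_1"
  where "basis_vec a i = (if i = a then 1 else 0)"

lemma lookup_mscale: "Poly_Mapping.lookup (mscale c F) m = c * Poly_Mapping.lookup F m"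
  unfolding mscale_def by (simp flip: mult_map_scale_conv_mult add: map.rep_eq when_def)

lemma var_add_eq_iff:
  "var i + var j = var a + var b \<longleftrightarrow> (i = a \<and> j = b) \<or> (i = b \<and> j = a)"
proof
  assume eq: "var i + var j = var a + var b"
  have "Poly_Mapping.lookup (var i + var j) x = Poly_Mapping.lookup (var a + var b) x" for x
    using eq by simp
  from this[of i] this[of j] show "(i = a \<and> j = b) \<or> (i = b \<and> j = a)"
    by (auto simp: lookup_add lookup_single when_def split: if_splits)
qed (auto simp: add.commute)

lemma monom_degree_add: "monom_degree (m + m') = monom_degree m + monom_degree m'"
  unfolding monom_degree_def by (simp add: lookup_add sum.distrib)

lemma monom_degree_var: "monom_degree (var (i :: 'n::finite)) = 1"
  unfolding monom_degree_def by (simp add: lookup_single when_def)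

lemma monom_degree_Suc:
  fixes m :: "'n::finite \<Rightarrow>\<^sub>0 nat"
  assumes "monom_degree m = Suc d"
  obtains i m' where "m = var i + m'" "monom_degree m' = d"
proof -
  obtain i where i: "Poly_Mapping.lookup m i \<noteq> 0"
    using assms unfolding monom_degree_def by (metis nat.distinct(1) sum.neutral)
  have m: "m = var i + (m - var i)"
    using i by (intro poly_mapping_eqI) (auto simp: lookup_add lookup_minus lookup_single when_def)
  with assms have "monom_degree (m - var i) = d"
    by (metis Suc_eq_plus1_left diff_Suc_1 monom_degree_add monom_degree_var)
  with m show ?thesis
    by (rule that)
qed

lemma monom_degree_0: "monom_degree (m :: 'n::finite \<Rightarrow>\<^sub>0 nat) = 0 \<Longrightarrow> m = 0"
  unfolding monom_degree_def by (intro poly_mapping_eqI) simp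

lemma homogeneous_linear_form: "homogeneous 1 (linear_form c)"
proof -
  have "Poly_Mapping.keys (linear_form c) \<subseteq> (\<Union>i. Poly_Mapping.keys (Poly_Mapping.single (var i) (c i)))"
    unfolding linear_form_def by (rule keys_sum)
  thus ?thesis
    unfolding homogeneous_def using monom_degree_var by (fastforce split: if_splits)
qed

lemma lookup_linear_form: "Poly_Mapping.lookup (linear_form c) (var i) = c i"
proof -
  have "var j = var i \<longleftrightarrow> j = i" for j
    by (metis lookup_single_eq lookup_single_not_eq zero_neq_one)
  thus ?thesis
    unfolding linear_form_def by (simp add: lookup_sum lookup_single when_def)
qed

lemma lookup_homogeneous_eq_0:
  "homogeneous d F \<Longrightarrow> monom_degree m \<noteq> d \<Longrightarrow> Poly_Mapping.lookup F m = 0"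
  unfolding homogeneous_def by (auto simp: in_keys_iff)

lemma homogeneous_1_linear_form:
  assumes "homogeneous 1 F"
  shows "F = linear_form (\<lambda>i. Poly_Mapping.lookup F (var i))" (is "F = ?L")
proof (rule poly_mapping_eqI)
  fix m
  show "Poly_Mapping.lookup F m = Poly_Mapping.lookup ?L m"
  proof (cases "monom_degree m = 1")
    case True
    then obtain i where "m = var i"
      by (metis One_nat_def monom_degree_Suc monom_degree_0 add.right_neutral)
    thus ?thesis
      by (simp add: lookup_linear_form[unfolded One_nat_def])
  next
    case False
    thus ?thesis
      using lookup_homogeneous_eq_0[OF assms] lookup_homogeneous_eq_0[OF homogeneous_linear_form]
      by metis
  qed
qed

lemma homogeneous_linear_form_mult:
  "homogeneous 2 (linear_form c * linear_form d)"
proof -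
  have "Poly_Mapping.keys (linear_form c * linear_form d)
      \<subseteq> {a + b | a b. a \<in> Poly_Mapping.keys (linear_form c) \<and> b \<in> Poly_Mapping.keys (linear_form d)}"
    by (rule keys_mult)
  thus ?thesis
    using homogeneous_linear_form[of c] homogeneous_linear_form[of d]
    unfolding homogeneous_def by (fastforce simp: monom_degree_add)
qed

lemma homogeneous_add:
  "homogeneous d F \<Longrightarrow> homogeneous d G \<Longrightarrow> homogeneous d (F + G)"
  using Poly_Mapping.keys_add[of F G] unfolding homogeneous_def by blast

lemma homogeneous_sum:
  assumes "\<And>i. i \<in> I \<Longrightarrow> homogeneous d (F i)"
  shows "homogeneous d (\<Sum>i\<in>I. F i)"
  using assms
proof (induction I rule: infinite_finite_induct)
  case (insert i I)
  thus ?case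
    by (simp add: homogeneous_add)
qed (simp_all add: homogeneous_def)

lemma polar_add: "polar (F + G) u v = polar F u v + polar G u v"
proof -
  have "polar_coeff (F + G) i j = polar_coeff F i j + polar_coeff G i j" for i j
    unfolding polar_coeff_def lookup_add by (rule distrib_left)
  thus ?thesis
    unfolding polar_def by (simp add: distrib_right sum.distrib)
qed

lemma polar_mscale: "polar (mscale c F) u v = c * polar F u v"
proof -
  have "polar_coeff (mscale c F) i j = c * polar_coeff F i j" for i j
    unfolding polar_coeff_def lookup_mscale by (rule mult.left_commute)
  thus ?thesis
    unfolding polar_def by (simp add: sum_distrib_left mult.assoc)
qed

lemma polar_0: "polar 0 u v = 0"
  unfolding polar_def polar_coeff_def by simp

lemma polar_sum: "polar (\<Sum>i\<in>I. F i) u v = (\<Sum>i\<in>I. polar (F i) u v)"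
  by (induction I rule: infinite_finite_induct) (simp_all add: polar_add polar_0)

lemma polar_sym: "polar F u v = polar F v u"
proof -
  have "polar_coeff F i j = polar_coeff F j i" for i j
    unfolding polar_coeff_def by (simp add: add.commute eq_commute)
  thus ?thesis
    unfolding polar_def by (subst sum.swap) (simp add: ac_simps)
qed

lemma polar_add_left: "polar F (\<lambda>i. u i + w i) v = polar F u v + polar F w v"
  unfolding polar_def by (simp add: distrib_left distrib_right sum.distrib)

lemma polar_diff_left: "polar F (\<lambda>i. u i - w i) v = polar F u v - polar F w v"
  unfolding polar_def by (simp add: left_diff_distrib right_diff_distrib sum_subtractf)

lemma polar_add_right: "polar F u (\<lambda>i. v i + w i) = polar F u v + polar F u w"
  unfolding polar_sym[of F u] by (rule polar_add_left)

lemma polar_diff_right: "polar F u (\<lambda>i. v i - w i) = polar F u v - polar F u w"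
  unfolding polar_sym[of F u] by (rule polar_diff_left)

lemma polar_lincomb_left:
  "polar F (\<lambda>i. \<Sum>m\<in>I. c m * u m i) v = (\<Sum>m\<in>I. c m * polar F (u m) v)"
proof -
  have "polar F (\<lambda>i. c * u i) v = c * polar F u v" for c u
    unfolding polar_def by (simp add: sum_distrib_left mult.left_commute mult.assoc)
  moreover have "polar F (\<lambda>i. 0) v = 0"
    unfolding polar_def by simp
  ultimately show ?thesis
    by (induction I rule: infinite_finite_induct) (simp_all add: polar_add_left)
qed

lemma mult_indicator:
  "x * (if P then 1 else 0) = (if P then x else (0 :: 'a::comm_ring_1))"
  by simp

lemma polar_basis_vec: "polar F (basis_vec a) (basis_vec b) = polar_coeff F a b"
  unfolding polar_def basis_vec_def by (simp add: mult_indicator)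

text \<open>
  This is why a \<open>k\<close>-collapse bounds the rank by \<open>2k\<close>: the polar form of one product of linear
  forms is a sum of two bilinear forms of rank at most 1.
\<close>

lemma polar_linear_form_mult:
  "polar (linear_form c * linear_form d) u v =
    dual_pairing c u * dual_pairing d v + dual_pairing d u * dual_pairing c v"
proof -
  have lookup: "Poly_Mapping.lookup (linear_form c * linear_form d) (var a + var b) =
      (\<Sum>i\<in>UNIV. \<Sum>j\<in>UNIV. c i * d j when (i = a \<and> j = b) \<or> (i = b \<and> j = a))" for a b
    unfolding linear_form_def sum_product mult_single
    by (simp add: lookup_sum lookup_single var_add_eq_iff[unfolded One_nat_def])
  have single: "(\<Sum>i\<in>UNIV. \<Sum>j\<in>UNIV. c i * d j when (i = a \<and> j = b)) = c a * d b" for a b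
  proof -
    have "(c i * d j when (i = a \<and> j = b)) = (if j = b then if i = a then c i * d j else 0 else 0)"
      for i j
      by (simp add: when_def)
    thus ?thesis
      by simp
  qed
  have "(\<Sum>i\<in>UNIV. \<Sum>j\<in>UNIV. c i * d j when (i = a \<and> j = b) \<or> (i = b \<and> j = a)) =
      c a * d b + (if a = b then 0 else c b * d a)" for a b
  proof (cases "a = b")
    case False
    hence "(c i * d j when (i = a \<and> j = b) \<or> (i = b \<and> j = a)) =
        (c i * d j when (i = a \<and> j = b)) + (c i * d j when (i = b \<and> j = a))" for i j
      by (auto simp: when_def)
    thus ?thesis
      using False by (simp add: sum.distrib single)
  qed (simp add: single)
  hence "polar_coeff (linear_form c * linear_form d) a b = c a * d b + d a * c b" for a b
    unfolding polar_coeff_def lookup by (simp add: mult.commute)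
  thus ?thesis
    unfolding polar_def dual_pairing_def sum_product
    by (simp add: sum.distrib distrib_right mult.assoc mult.left_commute)
qed

text \<open>
  The polar form records only twice the coefficient of a square, so in characteristic 2 it would
  not determine the form.
\<close>

lemma quadratic_form_eqI:
  fixes F G :: "('n::finite, 'a::field) mpoly"
  assumes "homogeneous 2 F" "homogeneous 2 G" "(2 :: 'a) \<noteq> 0"
    and "\<And>a b. polar F (basis_vec a) (basis_vec b) = polar G (basis_vec a) (basis_vec b)"
  shows "F = G"
proof (rule poly_mapping_eqI)
  fix m
  show "Poly_Mapping.lookup F m = Poly_Mapping.lookup G m"
  proof (cases "monom_degree m = 2")
    case True
    then obtain i m' where "m = var i + m'" "monom_degree m' = 1"
      by (metis monom_degree_Suc numeral_2_eq_2 One_nat_def)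
    moreover from this obtain j where "m' = var j"
      by (metis One_nat_def monom_degree_Suc monom_degree_0 add.right_neutral)
    ultimately show ?thesis
      using assms(3) assms(4)[of i j] unfolding polar_basis_vec polar_coeff_def by (auto split: if_splits)
  next
    case False
    thus ?thesis
      using lookup_homogeneous_eq_0[OF assms(1)] lookup_homogeneous_eq_0[OF assms(2)] by metis
  qed
qed

section \<open>Minors of the polar form\<close>

definition polar_minor ::
    "nat \<Rightarrow> (nat \<Rightarrow> 'n \<Rightarrow> 'a) \<Rightarrow> (nat \<Rightarrow> 'n \<Rightarrow> 'a) \<Rightarrow> ('n::finite, 'a::comm_ring_1) mpoly \<Rightarrow> 'a"
  where "polar_minor m u v F = det (mat m m (\<lambda>(i, j). polar F (u i) (v j)))"

lemma polar_minor_polynomial: "polar_minor m u v \<in> polynomial_functions V"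
  unfolding polar_minor_def
proof (rule det_in_function_algebra)
  fix i j
  show "(\<lambda>F. polar F (u i) (v j)) \<in> polynomial_functions V"
    by (intro polynomial_functions.linear)
      (simp add: linear_functional_on_def polar_add polar_mscale)
qed (fact polynomial_functions.const polynomial_functions.add polynomial_functions.mult)+

lemma det_zero_column:
  fixes A :: "'a::comm_ring_1 mat"
  assumes "A \<in> carrier_mat n n" "j < n" "\<And>i. i < n \<Longrightarrow> A $$ (i, j) = 0"
  shows "det A = 0"
  unfolding det_col[OF assms(1)]
proof (intro sum.neutral ballI)
  fix p assume "p \<in> {p. p permutes {0..<n}}"
  hence "A $$ (p j, j) = 0"
    using assms(2,3) by (simp add: permutes_less)
  hence "(\<Prod>j<n. A $$ (p j, j)) = 0"
    using assms(2) by (intro prod_zero) auto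
  thus "signof p * (\<Prod>j<n. A $$ (p j, j)) = 0"
    by simp
qed

text \<open>
  The matrix of the polar form factors as \<open>P Q\<close> through a space of dimension \<open>2k\<close>, one dimension
  for each of the \<open>2k\<close> bilinear forms of rank at most 1. To use the product rule for determinants of
  square matrices, \<open>P\<close> is filled up with zero columns; there is at least one, since \<open>2k < m\<close>.
\<close>

lemma polar_minor_sum_of_products:
  fixes c d :: "nat \<Rightarrow> 'n::finite \<Rightarrow> 'a::comm_ring_1"
  assumes "2 * k < m"
  shows "polar_minor m u v (\<Sum>i<k. linear_form (c i) * linear_form (d i)) = 0"
proof -
  define P where "P = mat m m (\<lambda>(a, b). if b < k then dual_pairing (c b) (u a)
    else if b < 2 * k then dual_pairing (d (b - k)) (u a) else 0)"
  (* The rows of Q from 2 * k on are multiplied by zero columns of P and may be arbitrary. *)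
  define Q where "Q = mat m m (\<lambda>(a, b). if a < k then dual_pairing (d a) (v b)
    else dual_pairing (c (a - k)) (v b))"
  have "mat m m (\<lambda>(i, j). polar (\<Sum>i<k. linear_form (c i) * linear_form (d i)) (u i) (v j)) = P * Q"
  proof (intro eq_matI)
    fix i j assume "i < dim_row (P * Q)" "j < dim_col (P * Q)"
    hence ij: "i < m" "j < m"
      by (simp_all add: P_def Q_def)
    define f where "f = (\<lambda>b. P $$ (i, b) * Q $$ (b, j))"
    have "(P * Q) $$ (i, j) = (\<Sum>b = 0..<m. f b)"
      using ij unfolding f_def by (simp add: P_def Q_def scalar_prod_def)
    also have "\<dots> = (\<Sum>b = 0..<2 * k. f b)"
      using assms ij by (intro sum.mono_neutral_right) (auto simp: f_def P_def)
    also have "\<dots> = (\<Sum>b = 0..<k. f b) + (\<Sum>b = 0..<k. f (b + k))"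
      using sum.atLeastLessThan_concat[of 0 k "2 * k" f] sum.shift_bounds_nat_ivl[of f 0 k k]
      by (simp add: mult_2)
    also have "\<dots> = (\<Sum>b<k. dual_pairing (c b) (u i) * dual_pairing (d b) (v j)
        + dual_pairing (d b) (u i) * dual_pairing (c b) (v j))"
      using assms ij by (simp add: f_def P_def Q_def lessThan_atLeast0 sum.distrib)
    finally show "mat m m (\<lambda>(i, j). polar (\<Sum>i<k. linear_form (c i) * linear_form (d i)) (u i) (v j))
        $$ (i, j) = (P * Q) $$ (i, j)"
      using ij by (simp add: polar_sum polar_linear_form_mult)
  qed (simp_all add: P_def Q_def)
  moreover have "P \<in> carrier_mat m m" "Q \<in> carrier_mat m m"
    by (simp_all add: P_def Q_def)
  moreover have "det P = 0"
    using assms by (intro det_zero_column[of _ m "2 * k"]) (auto simp: P_def)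
  ultimately show ?thesis
    unfolding polar_minor_def by (simp add: det_mult)
qed

lemma form_total_degree_1:
  assumes "is_form F" "total_degree F = 1"
  shows "homogeneous 1 F"
proof -
  obtain d where d: "homogeneous d F"
    using assms(1) unfolding is_form_def by blast
  have "total_degree F \<in> insert 0 (monom_degree ` Poly_Mapping.keys F)"
    unfolding total_degree_def by (intro Max_in) auto
  with assms(2) d have "d = 1"
    unfolding homogeneous_def by auto
  thus ?thesis
    using d by simp
qed

lemma quadratic_total_degree:
  assumes "homogeneous 2 F" "F \<noteq> 0"
  shows "total_degree F = 2"
proof -
  have "monom_degree ` Poly_Mapping.keys F = {2}"
    using assms unfolding homogeneous_def by (force simp flip: keys_eq_empty)
  thus ?thesis
    unfolding total_degree_def by simp
qed

text \<open>
  In degree 2 the degree conditions on a collapse leave only products of two linear forms; a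
  product with a zero factor is rewritten as a product of two zero linear forms.
\<close>

lemma collapse_polar_minor:
  assumes "has_collapse k F" "homogeneous 2 F" "2 * k < m"
  shows "polar_minor m u v F = 0"
proof (cases "F = 0")
  case True
  thus ?thesis
    using polar_minor_sum_of_products[of 0 m u v] assms(3) by simp
next
  case False
  obtain G H where F: "F = (\<Sum>i=1..k. G i * H i)"
    and GH: "\<And>i. i \<in> {1..k} \<Longrightarrow>
      (G i = 0 \<or> is_form (G i) \<and> 0 < total_degree (G i) \<and> total_degree (G i) < total_degree F) \<and>
      (H i = 0 \<or> is_form (H i) \<and> total_degree (H i) = total_degree F - total_degree (G i))"
    using assms(1) unfolding has_collapse_def by blast
  have prod: "\<exists>c d. G i * H i = linear_form c * linear_form d" if "i \<in> {1..k}" for i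
  proof (cases "G i = 0 \<or> H i = 0")
    case True
    have "G i * H i = linear_form (\<lambda>_. 0) * linear_form (\<lambda>_. 0)"
      using True by (auto simp: linear_form_def)
    thus ?thesis
      by blast
  next
    case False
    have "total_degree (G i) = 1" "total_degree (H i) = 1" "is_form (G i)" "is_form (H i)"
      using GH[OF that] False quadratic_total_degree[OF assms(2) \<open>F \<noteq> 0\<close>] by auto
    thus ?thesis
      by (metis form_total_degree_1 homogeneous_1_linear_form)
  qed
  have "\<exists>c d. \<forall>i\<in>{1..k}. G i * H i = linear_form (c i) * linear_form (d i)"
    using prod by metis
  then obtain c d where cd: "\<And>i. i \<in> {1..k} \<Longrightarrow> G i * H i = linear_form (c i) * linear_form (d i)"
    by blast
  have "F = (\<Sum>i<k. linear_form (c (Suc i)) * linear_form (d (Suc i)))"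
    unfolding F by (simp add: cd sum.atLeast1_atMost_eq)
  thus ?thesis
    using polar_minor_sum_of_products[OF assms(3)] by simp
qed

section \<open>Spaces of quadratic forms of bounded rank\<close>

text \<open>
  Normalises an invertible block of the polar form to the identity matrix, by multiplying with its
  inverse. Bordered determinants then become determinants of triangular matrices.
\<close>

lemma dual_vectors:
  fixes F :: "('n::finite, 'a::field) mpoly"
  assumes "polar_minor r u v F \<noteq> 0"
  obtains u' where "\<And>i j. i < r \<Longrightarrow> j < r \<Longrightarrow> polar F (u' i) (v j) = (if i = j then 1 else 0)"
proof -
  define A where "A = mat r r (\<lambda>(i, j). polar F (u i) (v j))"
  have A: "A \<in> carrier_mat r r" "det A \<noteq> 0"
    using assms unfolding A_def polar_minor_def by simp_all
  from det_non_zero_imp_unit[OF this, of "()"] obtain C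
    where C: "C \<in> carrier_mat r r" "C * A = 1\<^sub>m r"
    unfolding Units_def ring_mat_def by auto
  show ?thesis
  proof
    fix i j assume ij: "i < r" "j < r"
    have "polar F (\<lambda>a. \<Sum>m = 0..<r. C $$ (i, m) * u m a) (v j) = (C * A) $$ (i, j)"
      using ij C(1) unfolding polar_lincomb_left by (simp add: scalar_prod_def A_def)
    thus "polar F (\<lambda>a. \<Sum>m = 0..<r. C $$ (i, m) * u m a) (v j) = (if i = j then 1 else 0)"
      using C(2) ij by simp
  qed
qed

lemma det_triangular_ones:
  fixes A :: "'a::comm_ring_1 mat"
  assumes "A \<in> carrier_mat (Suc r) (Suc r)"
    and "upper_triangular A \<or> (\<forall>i j. i < j \<longrightarrow> j < Suc r \<longrightarrow> A $$ (i, j) = 0)"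
    and "\<And>i. i < r \<Longrightarrow> A $$ (Suc i, Suc i) = 1"
  shows "det A = A $$ (0, 0)"
proof -
  have "det A = (\<Prod>i = 0..<Suc r. A $$ (i, i))"
    using assms(1,2) det_upper_triangular[of A "Suc r"] det_lower_triangular[of "Suc r" A]
    by (auto simp: prod_list_diag_prod)
  also have "\<dots> = A $$ (0, 0) * (\<Prod>i = 0..<r. A $$ (Suc i, Suc i))"
    by (rule prod.atLeast0_lessThan_Suc_shift[unfolded comp_def])
  finally show ?thesis
    using assms(3) by simp
qed

text \<open>
  The vectors orthogonal to \<open>v\<^sub>0, \<dots>, v\<^bsub>r-1\<^esub>\<close> are already the kernel of the polar form when its
  rank is \<open>r\<close>: bordering the identity block with \<open>w\<close> and \<open>z\<close> gives a lower triangular matrix, whose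
  determinant \<open>polar F w z\<close> is a minor of size \<open>r + 1\<close>.
\<close>

lemma kernel_of_maximal_rank_form:
  fixes F :: "('n::finite, 'a::field) mpoly"
  assumes dual: "\<And>i j. i < r \<Longrightarrow> j < r \<Longrightarrow> polar F (u i) (v j) = (if i = j then 1 else 0)"
    and minor: "\<And>u v. polar_minor (Suc r) u v F = 0"
    and w: "\<And>j. j < r \<Longrightarrow> polar F w (v j) = 0"
  shows "polar F w z = 0"
proof -
  let ?A = "mat (Suc r) (Suc r) (\<lambda>(i, j). polar F (case_nat w u i) (case_nat z v j))"
  have "det ?A = ?A $$ (0, 0)"
    by (rule det_triangular_ones[of _ r]) (auto simp: dual w split: nat.splits)
  thus ?thesis
    using minor[of "case_nat w u" "case_nat z v"] unfolding polar_minor_def by simp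
qed

text \<open>
  The first-order argument on the line \<open>F + t G\<close>. Since \<open>w\<close> is in the kernel of \<open>F\<close>, the row of the
  bordered matrix that belongs to \<open>w\<close> is divisible by \<open>t\<close>. After division the determinant still
  vanishes for \<open>t \<noteq> 0\<close>, hence also for \<open>t = 0\<close>, being a polynomial in \<open>t\<close>. At \<open>t = 0\<close> the matrix is
  upper triangular with diagonal \<open>polar G w w, 1, \<dots>, 1\<close>.
\<close>

lemma bounded_rank_vanishes_on_kernel:
  fixes V :: "('n::finite, 'a::field) mpoly set"
  assumes inf: "infinite (UNIV :: 'a set)"
    and V: "mpoly.subspace V" "F \<in> V" "G \<in> V"
    and dual: "\<And>i j. i < r \<Longrightarrow> j < r \<Longrightarrow> polar F (u i) (v j) = (if i = j then 1 else 0)"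
    and minor: "\<And>H u v. H \<in> V \<Longrightarrow> polar_minor (Suc r) u v H = 0"
    and w: "\<And>j. j < r \<Longrightarrow> polar F w (v j) = 0"
  shows "polar G w w = 0"
proof -
  have ker: "polar F w z = 0" for z
    using kernel_of_maximal_rank_form[OF dual minor[OF V(2)] w] by blast
  have ker': "polar F z w = 0" for z
    using ker polar_sym by metis
  define u' v' where "u' = case_nat w u" and "v' = case_nat w v"
  (* The bordered matrix of F + t G, with its row 0 divided by t. *)
  define e where "e i j t = (if i = 0 then polar G w (v' j)
    else polar F (u' i) (v' j) + t * polar G (u' i) (v' j))" for i j :: nat and t :: 'a
  define N where "N t = mat (Suc r) (Suc r) (\<lambda>(i, j). e i j t)" for t
  have "(\<lambda>t. det (N t)) \<in> polynomial_in_one_var"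
    unfolding N_def
  proof (rule det_in_function_algebra)
    show "e i j \<in> polynomial_in_one_var" for i j
      by (cases "i = 0") (auto intro!: polynomial_in_one_var_intros simp: e_def[abs_def])
  qed (auto intro: polynomial_in_one_var_intros)
  moreover have "det (N t) = 0" if "t \<notin> {0}" for t
  proof -
    have "mat (Suc r) (Suc r) (\<lambda>(i, j). polar (F + mscale t G) (u' i) (v' j)) = multrow 0 t (N t)"
      by (intro eq_matI) (auto simp: N_def e_def polar_add polar_mscale u'_def ker mat_multrow_gen_def)
    hence "polar_minor (Suc r) u' v' (F + mscale t G) = t * det (N t)"
      unfolding polar_minor_def by (simp add: det_multrow[of 0 "Suc r"] N_def)
    moreover have "F + mscale t G \<in> V"
      using V by (intro mpoly.subspace_add mpoly.subspace_scale)
    ultimately show ?thesis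
      using minor that by simp
  qed
  ultimately have "det (N 0) = 0"
    by (rule polynomial_in_one_var_eq_0[OF inf _ finite.insertI[OF finite.emptyI]])
  moreover have "det (N 0) = N 0 $$ (0, 0)"
    by (rule det_triangular_ones[of _ r])
      (auto simp: N_def e_def u'_def v'_def dual ker' intro!: upper_triangularI split: nat.splits)
  ultimately show ?thesis
    by (simp add: N_def e_def v'_def)
qed

text \<open>
  The vectors \<open>u\<^sub>j\<close> are dual to the linear forms \<open>l\<^sub>j = polar F _ (v\<^sub>j)\<close>, so every vector is the sum of
  its component \<open>\<Sum>\<^sub>j l\<^sub>j u\<^sub>j\<close> and its projection to the common zero space of the \<open>l\<^sub>j\<close>. Expanding \<open>G\<close>
  along this decomposition, the term with two projections is zero, and every other term has a
  factor \<open>l\<^sub>j\<close>.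
\<close>

lemma vanishing_quadratic_in_ideal:
  fixes F G :: "('n::finite, 'a::field) mpoly" and r :: nat
  assumes two: "(2 :: 'a) \<noteq> 0" and G: "homogeneous 2 G"
    and dual: "\<And>i j. i < r \<Longrightarrow> j < r \<Longrightarrow> polar F (u i) (v j) = (if i = j then 1 else 0)"
    and vanish: "\<And>w. (\<And>j. j < r \<Longrightarrow> polar F w (v j) = 0) \<Longrightarrow> polar G w w = 0"
  shows "G \<in> ideal.span ((\<lambda>j. linear_form (\<lambda>a. polar F (basis_vec a) (v j))) ` {..<r})"
proof -
  define l where "l j a = polar F (basis_vec a) (v j)" for j a
  define h where "h a = (\<lambda>i. \<Sum>j<r. l j a * u j i)" for a
  define \<pi> where "\<pi> a = (\<lambda>i. basis_vec a i - h a i)" for a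
  (* The cofactor of l j in G. The term in (h a, h b) is contributed by both l j a * m j b and
     l j b * m j a, hence the factor one half. *)
  define m where "m j b = polar G (u j) (basis_vec b) - polar G (u j) (h b) / 2" for j b
  have \<pi>: "polar F (\<pi> a) (v j) = 0" if "j < r" for a j
  proof -
    have "polar F (h a) (v j) = (\<Sum>i<r. l i a * (if i = j then 1 else 0))"
      unfolding h_def polar_lincomb_left using dual that by (intro sum.cong) auto
    also have "\<dots> = l j a"
      unfolding mult_indicator using that by (subst sum.delta) auto
    finally show ?thesis
      unfolding \<pi>_def polar_diff_left l_def by simp
  qed
  (* Polarisation: G vanishes on the zero space as a quadratic form, so also as a bilinear form. *)
  have "polar G (\<pi> a) (\<pi> b) = 0" for a b
  proof -
    have "polar G (\<lambda>i. \<pi> a i + \<pi> b i) (\<lambda>i. \<pi> a i + \<pi> b i) = 0"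
      by (rule vanish) (simp add: polar_add_left \<pi>)
    hence "polar G (\<pi> a) (\<pi> a) + polar G (\<pi> b) (\<pi> b) + 2 * polar G (\<pi> a) (\<pi> b) = 0"
      unfolding polar_add_left polar_add_right polar_sym[of G "\<pi> b" "\<pi> a"]
      by (simp add: algebra_simps)
    thus ?thesis
      using two vanish[of "\<pi> a"] vanish[of "\<pi> b"] \<pi> by simp
  qed
  hence split: "polar G (basis_vec a) (basis_vec b) =
      polar G (h a) (basis_vec b) + polar G (h b) (basis_vec a) - polar G (h a) (h b)" for a b
    unfolding \<pi>_def polar_diff_left polar_diff_right polar_sym[of G "h b" "basis_vec a"]
    by (simp add: algebra_simps)
  have half: "x / 2 + x / 2 = x" for x :: 'a
    using two by (simp flip: mult_2)
  have regroup: "x - z + (y - z) = x + y - (z + z)" for x y z :: 'a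
    by (simp add: algebra_simps)
  have lm: "(\<Sum>j<r. l j a * m j b) = polar G (h a) (basis_vec b) - polar G (h a) (h b) / 2" for a b
    unfolding m_def h_def[of a] polar_lincomb_left
    by (simp add: algebra_simps sum_subtractf sum_divide_distrib)
  have pair: "dual_pairing c (basis_vec a) = c a" for c :: "'n \<Rightarrow> 'a" and a
    unfolding dual_pairing_def basis_vec_def by (simp add: if_distrib cong: if_cong)
  have "G = (\<Sum>j<r. linear_form (m j) * linear_form (l j))"
  proof (rule quadratic_form_eqI[OF G _ two])
    show "homogeneous 2 (\<Sum>j<r. linear_form (m j) * linear_form (l j))"
      by (intro homogeneous_sum homogeneous_linear_form_mult)
    fix a b
    have "polar (\<Sum>j<r. linear_form (m j) * linear_form (l j)) (basis_vec a) (basis_vec b) =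
        (\<Sum>j<r. l j a * m j b) + (\<Sum>j<r. l j b * m j a)"
      by (simp add: polar_sum polar_linear_form_mult pair sum.distrib mult.commute)
    also have "\<dots> = polar G (basis_vec a) (basis_vec b)"
      unfolding lm split polar_sym[of G "h b" "h a"] regroup half ..
    finally show "polar G (basis_vec a) (basis_vec b) =
        polar (\<Sum>j<r. linear_form (m j) * linear_form (l j)) (basis_vec a) (basis_vec b)" ..
  qed
  moreover have "(\<Sum>j<r. linear_form (m j) * linear_form (l j)) \<in>
      ideal.span ((\<lambda>j. linear_form (\<lambda>a. polar F (basis_vec a) (v j))) ` {..<r})"
    by (intro ideal.span_sum ideal.span_scale ideal.span_base) (auto simp: l_def[abs_def])
  ultimately show ?thesis
    by simp
qed

text \<open>
  A linear space of quadratic forms of rank at most \<open>n\<close> lies in an ideal generated by \<open>n\<close> or fewer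
  linear forms: those that cut out the kernel of a member \<open>F\<close> of maximal rank.
\<close>

lemma bounded_rank_imp_in_linear_ideal:
  fixes V :: "('n::finite, 'a::field) mpoly set"
  assumes inf: "infinite (UNIV :: 'a set)" and two: "(2 :: 'a) \<noteq> 0"
    and V: "mpoly.subspace V" "\<And>F. F \<in> V \<Longrightarrow> homogeneous 2 F"
    and minors: "\<And>F u v. F \<in> V \<Longrightarrow> polar_minor (Suc n) u v F = 0"
  obtains L where "finite L" "card L \<le> n" "\<And>l. l \<in> L \<Longrightarrow> homogeneous 1 l" "V \<subseteq> ideal.span L"
proof -
  (* The maximal rank r is the last size for which the minors do not all vanish on V; size 0 is
     a start because the empty determinant is 1. *)
  define Z where "Z m \<longleftrightarrow> (\<forall>F\<in>V. \<forall>u v. polar_minor m u v F = 0)" for m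
  have "0 \<in> V"
    using V(1) by (rule mpoly.subspace_0)
  hence "\<not> Z 0"
    unfolding Z_def polar_minor_def by auto
  moreover have "Z (Suc n)"
    using minors unfolding Z_def by blast
  ultimately obtain r where "r < Suc n" and r: "\<not> Z r" "Z (Suc r)"
    using ex_least_nat_less[of Z "Suc n"] by (metis order_refl)
  hence "r \<le> n"
    by simp
  obtain F u0 v where F: "F \<in> V" "polar_minor r u0 v F \<noteq> 0"
    using r(1) unfolding Z_def by blast
  from dual_vectors[OF F(2)] obtain u
    where dual: "\<And>i j. i < r \<Longrightarrow> j < r \<Longrightarrow> polar F (u i) (v j) = (if i = j then 1 else 0)"
    by metis
  show ?thesis
  proof
    let ?L = "(\<lambda>j. linear_form (\<lambda>a. polar F (basis_vec a) (v j))) ` {..<r}"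
    show "finite ?L" "card ?L \<le> n"
      using card_image_le[of "{..<r}"] \<open>r \<le> n\<close> by (auto intro: order_trans)
    show "homogeneous 1 l" if "l \<in> ?L" for l
      using that homogeneous_linear_form by auto
    show "V \<subseteq> ideal.span ?L"
    proof
      fix G assume G: "G \<in> V"
      show "G \<in> ideal.span ?L"
      proof (rule vanishing_quadratic_in_ideal[OF two V(2)[OF G] dual])
        fix w assume "\<And>j. j < r \<Longrightarrow> polar F w (v j) = 0"
        thus "polar G w w = 0"
          using r(2) unfolding Z_def
          by (intro bounded_rank_vanishes_on_kernel[OF inf V(1) F(1) G dual]) auto
      qed
    qed
  qed
qed

theorem theorem1p14:
  fixes V :: "('n::finite, 'a::alg_closed_field) mpoly set" and k :: nat
  assumes "CHAR('a) \<noteq> 2"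
    and "k > 0"
    and "mpoly.subspace V"
    and "\<And>F. F \<in> V \<Longrightarrow> homogeneous 2 F"
    and "\<And>L. finite L \<Longrightarrow> card L \<le> 2 * k \<Longrightarrow> (\<And>l. l \<in> L \<Longrightarrow> homogeneous 1 l)
      \<Longrightarrow> \<not> V \<subseteq> ideal.span L"
  shows "\<exists>U. openin (zariski_topology V) U
    \<and> zariski_topology V closure_of U = V
    \<and> (\<forall>F\<in>U. \<not> has_collapse k F)"
proof -
  have two: "(2 :: 'a) \<noteq> 0"
  proof
    assume "(2 :: 'a) = 0"
    hence "CHAR('a) dvd 2"
      using of_nat_eq_0_iff_char_dvd[of 2, where 'a = 'a] by simp
    hence "CHAR('a) = 1"
      using assms(1) two_is_prime_nat prime_nat_iff by blast
    thus False
      by simp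
  qed
  have "\<exists>F\<in>V. \<exists>u v. polar_minor (Suc (2 * k)) u v F \<noteq> 0"
    using bounded_rank_imp_in_linear_ideal[OF infinite_alg_closed two assms(3,4)] assms(5) by metis
  then obtain F u v where F: "F \<in> V" "polar_minor (Suc (2 * k)) u v F \<noteq> 0"
    by blast
  show ?thesis
  proof (intro exI conjI)
    let ?U = "{F \<in> V. polar_minor (Suc (2 * k)) u v F \<noteq> 0}"
    show "openin (zariski_topology V) ?U"
      by (intro nonvanishing_set_open polar_minor_polynomial)
    show "zariski_topology V closure_of ?U = V"
      using infinite_alg_closed assms(3) polar_minor_polynomial F by (rule nonvanishing_set_dense)
    show "\<forall>F\<in>?U. \<not> has_collapse k F"
      using collapse_polar_minor assms(4) by blast
  qed
qed

end
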